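(* Let $X$ be a Banach space such that $X^*$ has trivial type. Then, for every $k\in\mathbb N$, $$\operatorname{Helly}_X(k)\ge\frac{k}{2k-1}\ge\frac12.$$ In particular, $X$ does not have the Helly approximation property, i.e. $\operatorname{Helly}_X(k)$ does not tend to $0$ as $k\to\infty$.
   Context: A Banach space $E$ has Rademacher type $p\in[1,2]$ if there is a constant $T<\infty$ such that for every finite sequence $u_1,\dots,u_m\in E$, $\left(\mathbb E\|\sum_i\epsilon_i u_i\|^p\right)^{1/p}\le T\left(\sum_i\|u_i\|^p\right)^{1/p}$, where $\epsilon_i$ are independent uniform $\pm1$ random variables. $E$ has trivial type if $\sup\{p\in[1,2]: E\text{ has type }p\}=1$. $\mathbf B_X$ is the closed unit ball of $X$. $\operatorname{Helly}_X(k)$ is the infimum of all $\alpha>0$ such that: for every finite family $\mathcal F$ of convex subsets of $\mathbf B_X$, if every subfamily of $\mathcal F$ of size at most $k$ has non-empty intersection, then there is $x\in X$ with $\operatorname{dist}(x,C)\le\alpha$ for every $C\in\mathcal F$. $X$ has the Helly approximation property if $\operatorname{Helly}_X(k)\to0$ as $k\to\infty$. *)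

theory Defs
  imports "HOL-Probability.Probability"
begin

text \<open>
  Banach spaces are types of class \<^class>\<open>banach\<close> (real scalars), and the dual of \<open>'a\<close> is the
  type \<open>'a \<Rightarrow>\<^sub>L real\<close> of bounded linear functionals with the operator norm.
\<close>

definition has_rademacher_type :: "'a::real_normed_vector itself \<Rightarrow> real \<Rightarrow> bool" where
  "has_rademacher_type X p \<longleftrightarrow>
     (\<exists>T::real. \<forall>(m::nat) (u :: nat \<Rightarrow> 'a).
        (measure_pmf.expectation (Pi_pmf {..<m} 0 (\<lambda>_. pmf_of_set {-1, 1::real}))
           (\<lambda>\<epsilon>. norm (\<Sum>i<m. \<epsilon> i *\<^sub>R u i) powr p)) powr (1 / p)
        \<le> T * (\<Sum>i<m. norm (u i) powr p) powr (1 / p))"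

text \<open>The set below always contains \<open>1\<close>, so its \<^const>\<open>Sup\<close> in the reals is the true supremum.\<close>

definition trivial_type :: "'a::real_normed_vector itself \<Rightarrow> bool" where
  "trivial_type X \<longleftrightarrow> Sup {p \<in> {1..2}. has_rademacher_type X p} = 1"

definition helly_bound :: "'a::real_normed_vector itself \<Rightarrow> nat \<Rightarrow> real \<Rightarrow> bool" where
  "helly_bound X k \<alpha> \<longleftrightarrow>
     (\<forall>\<F> :: 'a set set.
        finite \<F> \<and> (\<forall>C\<in>\<F>. convex C \<and> C \<subseteq> cball 0 1) \<and>
        (\<forall>\<G>. \<G> \<subseteq> \<F> \<and> card \<G> \<le> k \<longrightarrow> \<Inter>\<G> \<noteq> {})
        \<longrightarrow> (\<exists>x. \<forall>C\<in>\<F>. infdist x C \<le> \<alpha>))"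

text \<open>
  Only \<open>k \<ge> 1\<close> is meaningful: then all members of an admissible family are non-empty, so the
  convention \<open>infdist x {} = 0\<close> plays no role, and \<open>\<alpha> = 1\<close> is always admissible, so \<^const>\<open>Inf\<close>
  is the infimum of a non-empty set of reals that is bounded below.
\<close>

definition Helly :: "'a::real_normed_vector itself \<Rightarrow> nat \<Rightarrow> real" where
  "Helly X k = Inf {\<alpha>. \<alpha> > 0 \<and> helly_bound X k \<alpha>}"

definition helly_approximation_property :: "'a::real_normed_vector itself \<Rightarrow> bool" where
  "helly_approximation_property X \<longleftrightarrow> Helly X \<longlonglongrightarrow> 0"

lemma has_rademacher_type_1: "has_rademacher_type (X :: 'a::real_normed_vector itself) 1"
proof -
  have "measure_pmf.expectation (Pi_pmf {..<m} 0 (\<lambda>_. pmf_of_set {-1, 1::real}))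
          (\<lambda>\<epsilon>. norm (\<Sum>i<m. \<epsilon> i *\<^sub>R u i)) \<le> (\<Sum>i<m. norm (u i))"
    for m :: nat and u :: "nat \<Rightarrow> 'a"
  proof -
    let ?P = "Pi_pmf {..<m} 0 (\<lambda>_. pmf_of_set {-1, 1::real})"
    have fin: "finite (set_pmf ?P)"
      by (rule finite_subset[OF set_Pi_pmf_subset']) (auto intro!: finite_PiE_dflt)
    have bound: "norm (\<Sum>i<m. \<epsilon> i *\<^sub>R u i) \<le> (\<Sum>i<m. norm (u i))" if "\<epsilon> \<in> set_pmf ?P" for \<epsilon>
    proof -
      have "\<epsilon> i \<in> {-1, 1}" if "i < m" for i
        using that \<open>\<epsilon> \<in> set_pmf ?P\<close> by (auto simp: set_Pi_pmf PiE_dflt_def)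
      hence "norm (\<epsilon> i *\<^sub>R u i) \<le> norm (u i)" if "i < m" for i
        using that by fastforce
      thus ?thesis by (intro sum_norm_le) auto
    qed
    have "measure_pmf.expectation ?P (\<lambda>\<epsilon>. norm (\<Sum>i<m. \<epsilon> i *\<^sub>R u i))
            \<le> measure_pmf.expectation ?P (\<lambda>_. \<Sum>i<m. norm (u i))"
      by (intro integral_mono_AE integrable_measure_pmf_finite fin)
         (auto simp: AE_measure_pmf_iff bound)
    thus ?thesis by simp
  qed
  thus ?thesis
    unfolding has_rademacher_type_def
    by (intro exI[of _ 1]) (auto simp: sum_nonneg Bochner_Integration.integral_nonneg)
qed

lemma helly_bound_1:
  assumes "k \<ge> 1"
  shows "helly_bound (X :: 'a::real_normed_vector itself) k 1"
  unfolding helly_bound_def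
proof (intro allI impI exI[of _ 0] ballI)
  fix \<F> :: "'a set set" and C
  assume *: "finite \<F> \<and> (\<forall>C\<in>\<F>. convex C \<and> C \<subseteq> cball 0 1) \<and>
        (\<forall>\<G>. \<G> \<subseteq> \<F> \<and> card \<G> \<le> k \<longrightarrow> \<Inter>\<G> \<noteq> {})" and C: "C \<in> \<F>"
  have "\<Inter>{C} \<noteq> {}"
    using * C assms by (metis card_1_singleton_iff One_nat_def empty_subsetI insert_subset)
  then obtain c where c: "c \<in> C" by auto
  have cb: "c \<in> cball 0 1" using * C c by blast
  have "infdist 0 C \<le> dist 0 c" by (rule infdist_le[OF c])
  also have "dist 0 c \<le> 1" using cb by simp
  finally show "infdist 0 C \<le> 1" .
qed

end

theory Submission imports Defs begin

text \<open>
  By Pisier's theorem, trivial type of the dual \<open>X*\<close> yields, for every \<open>n\<close>, functionals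
  \<open>f 0, \<dots>, f (n - 1)\<close> in its unit ball all of whose signed sums have norm almost \<open>n\<close>. Taking
  \<open>n = 2 ^ card J\<close> and indexing the functionals by the sign patterns on a finite set \<open>J\<close>, this
  dualises to vectors \<open>y j\<close> (\<open>j \<in> J\<close>) of \<open>X\<close> that span an almost isometric copy of \<open>l1\<close>.
  Let \<open>J\<close> be the set of \<open>k\<close>-subsets of a \<open>2 k\<close>-set and let \<open>C i\<close> be the convex hull of
  the \<open>y S\<close> with \<open>i \<in> S\<close>. Any \<open>k\<close> of the sets \<open>C i\<close> share a vector \<open>y S\<close>. If \<open>x\<close> is within
  \<open>\<alpha>\<close> of all of them, the approximants in \<open>C i\<close> have pairwise distance at most \<open>2 \<alpha>\<close>; but
  averaging over \<open>j\<close> shows that the weights of two of them overlap in mass at most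
  \<open>(k - 1) / (2 k - 1)\<close>, so they are almost \<open>2 k / (2 k - 1)\<close> apart.

  Pisier's theorem is proved by contraposition. If \<open>n\<close> vectors in the unit ball always admit a
  signed sum of norm at most \<open>(1 - \<delta>) n\<close>, the second moments of random signed sums of \<open>n\<close> vectors
  improve on the Cauchy-Schwarz bound by a factor \<open>\<theta> < 1\<close>; the improvement is multiplicative when
  vectors are grouped into blocks, which beats the loss from a type exponent slightly above \<open>1\<close>.
\<close>

section \<open>Averages over sign patterns\<close>

text \<open>The value 0 off \<open>A\<close> is the default value of \<open>Pi_pmf\<close> in the
  definition of type, so these patterns are exactly the support of that distribution.\<close>

definition signs :: "'i set \<Rightarrow> ('i \<Rightarrow> real) set" where
  "signs A = PiE_dflt A 0 (\<lambda>_. {-1, 1})"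

definition sign_avg :: "'i set \<Rightarrow> (('i \<Rightarrow> real) \<Rightarrow> real) \<Rightarrow> real" where
  "sign_avg A F = (\<Sum>\<epsilon>\<in>signs A. F \<epsilon>) / 2 ^ card A"

lemma finite_signs [simp]: "finite A \<Longrightarrow> finite (signs A)"
  unfolding signs_def by (intro finite_PiE_dflt) auto

lemma card_signs: "finite A \<Longrightarrow> card (signs A) = 2 ^ card A"
  unfolding signs_def by (subst card_PiE_dflt) (auto simp: numeral_2_eq_2)

lemma signs_abs_le: "\<epsilon> \<in> signs A \<Longrightarrow> \<bar>\<epsilon> i\<bar> \<le> 1"
  unfolding signs_def PiE_dflt_def by (cases "i \<in> A") auto

lemma signs_cases: "\<epsilon> \<in> signs A \<Longrightarrow> i \<in> A \<Longrightarrow> \<epsilon> i = -1 \<or> \<epsilon> i = 1"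
  unfolding signs_def PiE_dflt_def by auto

lemma norm_signed_sum_le:
  fixes x :: "'i \<Rightarrow> 'a::real_normed_vector"
  assumes "\<epsilon> \<in> signs A"
  shows "norm (\<Sum>i\<in>B. \<epsilon> i *\<^sub>R x i) \<le> (\<Sum>i\<in>B. norm (x i))"
proof (rule sum_norm_le)
  fix i
  show "norm (\<epsilon> i *\<^sub>R x i) \<le> norm (x i)"
    using mult_right_mono[OF signs_abs_le[OF assms, of i] norm_ge_zero[of "x i"]] by simp
qed

lemma sign_avg_mono:
  assumes "\<And>\<epsilon>. \<epsilon> \<in> signs A \<Longrightarrow> F \<epsilon> \<le> G \<epsilon>"
  shows "sign_avg A F \<le> sign_avg A G"
  unfolding sign_avg_def using assms by (intro divide_right_mono sum_mono) auto

lemma sign_avg_const [simp]: "finite A \<Longrightarrow> sign_avg A (\<lambda>_. c) = c"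
  by (simp add: sign_avg_def card_signs)

lemma sign_avg_cmult: "sign_avg A (\<lambda>\<epsilon>. c * F \<epsilon>) = c * sign_avg A F"
  by (simp add: sign_avg_def sum_distrib_left)

lemma sign_avg_sum: "sign_avg A (\<lambda>\<epsilon>. \<Sum>j\<in>J. F j \<epsilon>) = (\<Sum>j\<in>J. sign_avg A (F j))"
  unfolding sign_avg_def sum_divide_distrib[symmetric] by (subst sum.swap) simp

lemma sign_avg_add: "sign_avg A (\<lambda>\<epsilon>. F \<epsilon> + G \<epsilon>) = sign_avg A F + sign_avg A G"
  by (simp add: sign_avg_def sum.distrib add_divide_distrib)

lemma sign_avg_swap:
  "sign_avg A (\<lambda>\<epsilon>. sign_avg B (\<lambda>\<eta>. F \<epsilon> \<eta>)) = sign_avg B (\<lambda>\<eta>. sign_avg A (\<lambda>\<epsilon>. F \<epsilon> \<eta>))"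
  unfolding sign_avg_def sum_divide_distrib[symmetric] by (subst sum.swap) (simp add: mult.commute)

text \<open>Multiplication by \<sigma> is an involution of \<open>signs A\<close>. Values of
  \<sigma> off \<open>A\<close> are harmless, because every pattern vanishes there.\<close>

lemma sign_avg_flip:
  assumes "\<And>i. i \<in> A \<Longrightarrow> \<sigma> i = -1 \<or> \<sigma> i = (1::real)"
  shows "sign_avg A (\<lambda>\<epsilon>. F (\<lambda>i. \<sigma> i * \<epsilon> i)) = sign_avg A F"
proof -
  have inv: "(\<lambda>i. \<sigma> i * (\<sigma> i * \<epsilon> i)) = \<epsilon>" and mem: "(\<lambda>i. \<sigma> i * \<epsilon> i) \<in> signs A"
    if "\<epsilon> \<in> signs A" for \<epsilon>
  proof -
    show "(\<lambda>i. \<sigma> i * (\<sigma> i * \<epsilon> i)) = \<epsilon>"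
    proof
      fix i show "\<sigma> i * (\<sigma> i * \<epsilon> i) = \<epsilon> i"
      proof (cases "i \<in> A")
        case True
        from assms[OF True] show ?thesis by (elim disjE) simp_all
      next
        case False
        thus ?thesis using that by (simp add: signs_def PiE_dflt_def)
      qed
    qed
    show "(\<lambda>i. \<sigma> i * \<epsilon> i) \<in> signs A"
      unfolding signs_def PiE_dflt_def
    proof (intro CollectI allI conjI impI)
      fix i
      show "\<sigma> i * \<epsilon> i \<in> {- 1, 1}" if "i \<in> A"
        using signs_cases[OF \<open>\<epsilon> \<in> signs A\<close> that] assms[OF that] by auto
      show "\<sigma> i * \<epsilon> i = 0" if "i \<notin> A"
        using \<open>\<epsilon> \<in> signs A\<close> that by (simp add: signs_def PiE_dflt_def)
    qed
  qed
  have "(\<Sum>\<epsilon>\<in>signs A. F (\<lambda>i. \<sigma> i * \<epsilon> i)) = (\<Sum>\<epsilon>\<in>signs A. F \<epsilon>)"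
    by (rule sum.reindex_bij_witness[where i = "\<lambda>\<epsilon> i. \<sigma> i * \<epsilon> i" and j = "\<lambda>\<epsilon> i. \<sigma> i * \<epsilon> i"])
       (simp_all only: inv mem)
  thus ?thesis by (simp add: sign_avg_def)
qed

lemma rademacher_expectation_eq_sign_avg:
  assumes "finite A"
  shows "measure_pmf.expectation (Pi_pmf A 0 (\<lambda>_. pmf_of_set {-1, 1::real})) F = sign_avg A F"
proof -
  have "Pi_pmf A 0 (\<lambda>_. pmf_of_set {-1, 1::real}) = pmf_of_set (signs A)"
    unfolding signs_def using assms by (intro Pi_pmf_of_set) auto
  moreover have "signs A \<noteq> {}"
    using card_signs[OF assms] by auto
  ultimately show ?thesis
    using assms by (simp add: integral_pmf_of_set sign_avg_def card_signs)
qed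

section \<open>Second moments of signed sums\<close>

text \<open>Two sources of gain: if some norm lies well below the mean, Cauchy-Schwarz is strict by
  a fixed factor; otherwise the good pattern for the normalised vectors also shortens the sum of the
  original ones, and one short sum among the \<open>2 ^ n\<close> lowers the average.\<close>

lemma b_convex_imp_average_bound:
  assumes n: "n \<ge> 1" and \<delta>: "\<delta> > 0"
  assumes bconv: "\<And>u :: nat \<Rightarrow> 'a::real_normed_vector. (\<And>i. norm (u i) \<le> 1) \<Longrightarrow>
     \<exists>\<epsilon>\<in>signs {..<n}. norm (\<Sum>i<n. \<epsilon> i *\<^sub>R u i) \<le> (1 - \<delta>) * real n"
  shows "\<exists>\<theta>. 0 < \<theta> \<and> \<theta> < 1 \<and> (\<forall>y :: nat \<Rightarrow> 'a.
     sign_avg {..<n} (\<lambda>\<epsilon>. (norm (\<Sum>i<n. \<epsilon> i *\<^sub>R y i))\<^sup>2) \<le> \<theta> * real n * (\<Sum>i<n. (norm (y i))\<^sup>2))"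
proof -
  \<comment> \<open>The first entry is the gain from one good pattern among \<open>2 ^ n\<close>,
    the second the gain in Cauchy-Schwarz when one norm is below half the mean.\<close>
  define \<theta> where "\<theta> = max (1 - \<delta> / 2 ^ (n + 1)) (4 * real n / (4 * real n + 1))"
  have "\<theta> \<ge> 4 * real n / (4 * real n + 1)" by (simp add: \<theta>_def)
  moreover have "4 * real n / (4 * real n + 1) > 0" using n by simp
  ultimately have \<theta>0: "\<theta> > 0" by linarith
  have \<theta>1: "\<theta> < 1" using \<delta> n by (simp add: \<theta>_def)
  have main: "sign_avg {..<n} (\<lambda>\<epsilon>. (norm (\<Sum>i<n. \<epsilon> i *\<^sub>R y i))\<^sup>2) \<le> \<theta> * real n * (\<Sum>i<n. (norm (y i))\<^sup>2)"
    for y :: "nat \<Rightarrow> 'a"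
  proof -
    define S where "S = (\<Sum>i<n. norm (y i))"
    define Q where "Q = (\<Sum>i<n. (norm (y i))\<^sup>2)"
    have S0: "S \<ge> 0" by (simp add: S_def sum_nonneg)
    \<comment> \<open>Cauchy-Schwarz with its exact defect, the variance of the norms.\<close>
    have var: "(\<Sum>i<n. (norm (y i) - S / n)\<^sup>2) = Q - S\<^sup>2 / n"
    proof -
      have "(\<Sum>i<n. (norm (y i) - S / n)\<^sup>2) = (\<Sum>i<n. (norm (y i))\<^sup>2 - 2 * (S / n) * norm (y i) + (S / n)\<^sup>2)"
        by (intro sum.cong refl) (simp add: power2_eq_square algebra_simps)
      also have "\<dots> = Q - 2 * (S / n) * S + n * (S / n)\<^sup>2"
        by (simp add: sum.distrib sum_subtractf Q_def S_def sum_distrib_left)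
      also have "\<dots> = Q - S\<^sup>2 / n" using n by (simp add: field_simps power2_eq_square)
      finally show ?thesis .
    qed
    have "0 \<le> Q - S\<^sup>2 / n" unfolding var[symmetric] by (intro sum_nonneg) auto
    hence CS: "S\<^sup>2 \<le> n * Q" using n by (simp add: field_simps)
    have le_S: "(norm (\<Sum>i<n. \<epsilon> i *\<^sub>R y i))\<^sup>2 \<le> S\<^sup>2" if "\<epsilon> \<in> signs {..<n}" for \<epsilon>
      using norm_signed_sum_le[OF that, where B = "{..<n}" and x = y] by (intro power_mono) (auto simp: S_def)
    show ?thesis
    proof (cases "\<exists>i<n. norm (y i) < S / (2 * n)")
      case True
      then obtain i where i: "i < n" "norm (y i) < S / (2 * n)" by auto
      have "S / (2 * n) \<le> S / n - norm (y i)" using i n by (simp add: field_simps)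
      hence "(S / (2 * n))\<^sup>2 \<le> (S / n - norm (y i))\<^sup>2" using S0 by (intro power_mono) auto
      also have "\<dots> = (norm (y i) - S / n)\<^sup>2" by (simp add: power2_commute)
      also have "\<dots> \<le> (\<Sum>i<n. (norm (y i) - S / n)\<^sup>2)"
        using i by (intro member_le_sum) auto
      finally have "(S / (2 * n))\<^sup>2 \<le> Q - S\<^sup>2 / n" by (simp add: var)
      hence "(4 * n + 1) * S\<^sup>2 \<le> 4 * n * (n * Q)" using n by (simp add: field_simps power2_eq_square)
      hence S2: "S\<^sup>2 \<le> 4 * real n / (4 * real n + 1) * (n * Q)" by (simp add: field_simps)
      have "sign_avg {..<n} (\<lambda>\<epsilon>. (norm (\<Sum>i<n. \<epsilon> i *\<^sub>R y i))\<^sup>2) \<le> sign_avg {..<n} (\<lambda>_. S\<^sup>2)"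
        by (intro sign_avg_mono le_S)
      also have "\<dots> = S\<^sup>2" by simp
      also have "\<dots> \<le> 4 * real n / (4 * real n + 1) * (n * Q)" by (rule S2)
      also have "\<dots> \<le> \<theta> * (n * Q)"
        by (intro mult_right_mono) (auto simp: \<theta>_def Q_def intro!: mult_nonneg_nonneg sum_nonneg)
      finally show ?thesis by (simp add: Q_def mult.assoc)
    next
      case False
      define m where "m = S / (2 * n)"
      have m: "m \<le> norm (y i)" if "i < n" for i using False that unfolding m_def by (meson not_less)
      have m0: "m \<ge> 0" using S0 by (simp add: m_def)
      define u where "u i = (if i < n then y i /\<^sub>R norm (y i) else 0)" for i
      have u: "norm (u i) \<le> 1" for i by (cases "y i = 0") (auto simp: u_def)
      have yu: "y i = norm (y i) *\<^sub>R u i" if "i < n" for i using that by (cases "y i = 0") (auto simp: u_def)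
      obtain \<eta> where \<eta>: "\<eta> \<in> signs {..<n}" "norm (\<Sum>i<n. \<eta> i *\<^sub>R u i) \<le> (1 - \<delta>) * real n"
        using bconv[of u] u by auto
      \<comment> \<open>Every \<open>y i\<close> consists of a common part
        \<open>m *\<^sub>R u i\<close> and a remainder of length \<open>norm (y i) - m\<close>. The
        common part profits from the choice of \<eta>; the remainders are estimated by the triangle
        inequality.\<close>
      have "(\<Sum>i<n. \<eta> i *\<^sub>R y i) = m *\<^sub>R (\<Sum>i<n. \<eta> i *\<^sub>R u i) + (\<Sum>i<n. \<eta> i *\<^sub>R ((norm (y i) - m) *\<^sub>R u i))"
        unfolding scaleR_sum_right sum.distrib[symmetric]
      proof (intro sum.cong refl)
        fix i assume "i \<in> {..<n}"
        hence "\<eta> i *\<^sub>R y i = \<eta> i *\<^sub>R (norm (y i) *\<^sub>R u i)" using yu by auto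
        thus "\<eta> i *\<^sub>R y i = m *\<^sub>R \<eta> i *\<^sub>R u i + \<eta> i *\<^sub>R ((norm (y i) - m) *\<^sub>R u i)"
          by (simp add: algebra_simps)
      qed
      hence "norm (\<Sum>i<n. \<eta> i *\<^sub>R y i) \<le>
               m * norm (\<Sum>i<n. \<eta> i *\<^sub>R u i) + (\<Sum>i<n. norm ((norm (y i) - m) *\<^sub>R u i))"
        using norm_triangle_ineq[of "m *\<^sub>R (\<Sum>i<n. \<eta> i *\<^sub>R u i)" "\<Sum>i<n. \<eta> i *\<^sub>R ((norm (y i) - m) *\<^sub>R u i)"]
          norm_signed_sum_le[OF \<eta>(1), where B = "{..<n}" and x = "\<lambda>i. (norm (y i) - m) *\<^sub>R u i"] m0
        by simp
      also have "\<dots> \<le> m * ((1 - \<delta>) * real n) + (\<Sum>i<n. norm (y i) - m)"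
      proof (intro add_mono mult_left_mono sum_mono \<eta> m0)
        fix i assume "i \<in> {..<n}"
        thus "norm ((norm (y i) - m) *\<^sub>R u i) \<le> norm (y i) - m"
          using m[of i] mult_left_le[OF u[of i], of "norm (y i) - m"] by simp
      qed
      also have "\<dots> = S - m * n * \<delta>" by (simp add: sum_subtractf S_def algebra_simps)
      also have "\<dots> = S * (1 - \<delta> / 2)" using n by (simp add: m_def field_simps)
      finally have \<eta>S: "norm (\<Sum>i<n. \<eta> i *\<^sub>R y i) \<le> S * (1 - \<delta> / 2)" .
      have \<eta>S2: "(norm (\<Sum>i<n. \<eta> i *\<^sub>R y i))\<^sup>2 \<le> S\<^sup>2 * (1 - \<delta> / 2)"
      proof (cases "S = 0")
        case True thus ?thesis using \<eta>S by simp
      next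
        case False
        \<comment> \<open>Squaring requires \<open>1 - \<delta> / 2\<close> to be non-negative; this
          follows from the bound \<open>\<eta>S\<close> itself, whose left-hand side is a
          norm.\<close>
        have "0 \<le> S * (1 - \<delta> / 2)" using \<eta>S norm_ge_zero order_trans by blast
        hence d: "0 \<le> 1 - \<delta> / 2" using False S0 by (simp add: zero_le_mult_iff)
        have "(norm (\<Sum>i<n. \<eta> i *\<^sub>R y i))\<^sup>2 \<le> (S * (1 - \<delta> / 2))\<^sup>2" using \<eta>S by (intro power_mono) auto
        also have "\<dots> = S\<^sup>2 * ((1 - \<delta> / 2) * (1 - \<delta> / 2))" by (simp add: power2_eq_square)
        also have "\<dots> \<le> S\<^sup>2 * (1 - \<delta> / 2)" using d \<delta> by (intro mult_left_mono mult_left_le) auto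
        finally show ?thesis .
      qed
      \<comment> \<open>Only \<eta> contributes a saving; all other patterns get the trivial bound
        \<open>S^2\<close>.\<close>
      have "(\<Sum>\<epsilon>\<in>signs {..<n}. (norm (\<Sum>i<n. \<epsilon> i *\<^sub>R y i))\<^sup>2) =
          (norm (\<Sum>i<n. \<eta> i *\<^sub>R y i))\<^sup>2 + (\<Sum>\<epsilon>\<in>signs {..<n} - {\<eta>}. (norm (\<Sum>i<n. \<epsilon> i *\<^sub>R y i))\<^sup>2)"
        using \<eta> by (intro sum.remove) auto
      also have "\<dots> \<le> S\<^sup>2 * (1 - \<delta> / 2) + (\<Sum>\<epsilon>\<in>signs {..<n} - {\<eta>}. S\<^sup>2)"
        using \<eta>S2 le_S by (intro add_mono sum_mono) auto
      also have "\<dots> = S\<^sup>2 * (1 - \<delta> / 2) + (2 ^ n - 1) * S\<^sup>2"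
        using \<eta> by (simp add: card_Diff_singleton card_signs of_nat_diff)
      also have "\<dots> = 2 ^ n * (S\<^sup>2 * (1 - \<delta> / 2 ^ (n + 1)))" by (simp add: field_simps)
      finally have "sign_avg {..<n} (\<lambda>\<epsilon>. (norm (\<Sum>i<n. \<epsilon> i *\<^sub>R y i))\<^sup>2) \<le> S\<^sup>2 * (1 - \<delta> / 2 ^ (n + 1))"
        unfolding sign_avg_def by (subst pos_divide_le_eq) (simp_all add: mult.commute)
      also have "\<dots> \<le> S\<^sup>2 * \<theta>" by (intro mult_left_mono) (auto simp: \<theta>_def)
      also have "\<dots> \<le> (n * Q) * \<theta>" using CS \<theta>0 by (intro mult_right_mono) auto
      finally show ?thesis by (simp add: Q_def mult_ac)
    qed
  qed
  show ?thesis using \<theta>0 \<theta>1 main by blast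
qed

text \<open>Flipping all signs of a block simultaneously leaves the average unchanged, so the block sums
  may be given independent signs of their own.\<close>

lemma sign_avg_blocks:
  fixes x :: "'i \<Rightarrow> 'a::real_normed_vector"
  assumes A: "finite A" and B: "finite B" and g: "g ` B \<subseteq> {..<n}"
  assumes avg: "\<And>y :: nat \<Rightarrow> 'a. sign_avg {..<n} (\<lambda>\<epsilon>. (norm (\<Sum>i<n. \<epsilon> i *\<^sub>R y i))\<^sup>2) \<le> c * (\<Sum>i<n. (norm (y i))\<^sup>2)"
  shows "sign_avg A (\<lambda>\<epsilon>. (norm (\<Sum>i\<in>B. \<epsilon> i *\<^sub>R x i))\<^sup>2) \<le>
    c * (\<Sum>b<n. sign_avg A (\<lambda>\<epsilon>. (norm (\<Sum>i\<in>{i\<in>B. g i = b}. \<epsilon> i *\<^sub>R x i))\<^sup>2))"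
proof -
  define Y where "Y \<epsilon> b = (\<Sum>i\<in>{i\<in>B. g i = b}. \<epsilon> i *\<^sub>R x i)" for \<epsilon> :: "'i \<Rightarrow> real" and b
  define \<sigma> where "\<sigma> \<eta> i = (if g i < n then \<eta> (g i) else 1)" for \<eta> :: "nat \<Rightarrow> real" and i
  have flip: "(\<Sum>i\<in>B. (\<sigma> \<eta> i * \<epsilon> i) *\<^sub>R x i) = (\<Sum>b<n. \<eta> b *\<^sub>R Y \<epsilon> b)" for \<eta> \<epsilon>
  proof -
    have "(\<Sum>i\<in>B. (\<sigma> \<eta> i * \<epsilon> i) *\<^sub>R x i) = (\<Sum>b<n. \<Sum>i\<in>{i\<in>B. g i = b}. (\<sigma> \<eta> i * \<epsilon> i) *\<^sub>R x i)"
      using B g by (intro sum.group[symmetric]) auto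
    also have "\<dots> = (\<Sum>b<n. \<eta> b *\<^sub>R Y \<epsilon> b)"
      unfolding Y_def scaleR_sum_right by (intro sum.cong refl) (auto simp: \<sigma>_def)
    finally show ?thesis .
  qed
  have "sign_avg A (\<lambda>\<epsilon>. (norm (\<Sum>b<n. \<eta> b *\<^sub>R Y \<epsilon> b))\<^sup>2) = sign_avg A (\<lambda>\<epsilon>. (norm (\<Sum>i\<in>B. \<epsilon> i *\<^sub>R x i))\<^sup>2)"
    if "\<eta> \<in> signs {..<n}" for \<eta>
    unfolding flip[symmetric]
    using signs_cases[OF that]
    by (intro sign_avg_flip[where F = "\<lambda>\<epsilon>. (norm (\<Sum>i\<in>B. \<epsilon> i *\<^sub>R x i))\<^sup>2"]) (auto simp: \<sigma>_def)
  hence "sign_avg A (\<lambda>\<epsilon>. (norm (\<Sum>i\<in>B. \<epsilon> i *\<^sub>R x i))\<^sup>2)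
     \<le> sign_avg {..<n} (\<lambda>\<eta>. sign_avg A (\<lambda>\<epsilon>. (norm (\<Sum>b<n. \<eta> b *\<^sub>R Y \<epsilon> b))\<^sup>2))"
    using sign_avg_mono[of "{..<n}" "\<lambda>_. sign_avg A (\<lambda>\<epsilon>. (norm (\<Sum>i\<in>B. \<epsilon> i *\<^sub>R x i))\<^sup>2)"] by simp
  also have "\<dots> = sign_avg A (\<lambda>\<epsilon>. sign_avg {..<n} (\<lambda>\<eta>. (norm (\<Sum>b<n. \<eta> b *\<^sub>R Y \<epsilon> b))\<^sup>2))"
    by (rule sign_avg_swap)
  also have "\<dots> \<le> sign_avg A (\<lambda>\<epsilon>. c * (\<Sum>b<n. (norm (Y \<epsilon> b))\<^sup>2))"
    by (intro sign_avg_mono avg)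
  also have "\<dots> = c * (\<Sum>b<n. sign_avg A (\<lambda>\<epsilon>. (norm (Y \<epsilon> b))\<^sup>2))"
    by (simp add: sign_avg_cmult sign_avg_sum)
  finally show ?thesis unfolding Y_def .
qed

lemma obtain_partition_card_le:
  fixes B :: "'i set" and n q :: nat
  assumes "finite B" "card B \<le> n * q"
  obtains g where "g ` B \<subseteq> {..<n}" "\<And>b. card {i\<in>B. g i = b} \<le> q"
proof (cases "B = {}")
  case True thus ?thesis using that[of "\<lambda>_. 0"] by auto
next
  case False
  hence q: "q > 0" using assms by (cases q) auto
  obtain h where h: "bij_betw h B {0..<card B}" using ex_bij_betw_finite_nat[OF assms(1)] by blast
  show ?thesis
  proof (rule that[of "\<lambda>i. h i div q"])
    show "(\<lambda>i. h i div q) ` B \<subseteq> {..<n}"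
    proof
      fix j assume "j \<in> (\<lambda>i. h i div q) ` B"
      then obtain i where "i \<in> B" "j = h i div q" by auto
      moreover from this have "h i < n * q" using bij_betwE[OF h] assms(2) by fastforce
      ultimately show "j \<in> {..<n}" using q by (simp add: div_less_iff_less_mult)
    qed
    fix b
    have "card {i\<in>B. h i div q = b} = card (h ` {i\<in>B. h i div q = b})"
      using h by (intro card_image[symmetric]) (auto simp: bij_betw_def inj_on_def)
    also have "\<dots> \<le> card {b * q..<b * q + q}"
    proof (intro card_mono subsetI)
      fix j assume "j \<in> h ` {i \<in> B. h i div q = b}"
      hence "j div q = b" by auto
      thus "j \<in> {b * q..<b * q + q}"
        using q div_times_less_eq_dividend[of j q] dividend_less_div_times[of q j] by (simp add: add.commute)
    qed simp
    finally show "card {i\<in>B. h i div q = b} \<le> q" by simp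
  qed
qed

text \<open>By induction, each splitting into \<open>n\<close> blocks costs one factor
  \<open>c\<close>. Plain Cauchy-Schwarz is the case \<open>c = n\<close>; with
  \<open>c = \<theta> * n\<close> the gain after \<open>k\<close> splittings is
  \<open>\<theta> ^ k\<close>.\<close>

lemma sign_avg_power_bound:
  fixes x :: "'i \<Rightarrow> 'a::real_normed_vector"
  assumes A: "finite A" and c: "c \<ge> 0"
  assumes avg: "\<And>y :: nat \<Rightarrow> 'a. sign_avg {..<n} (\<lambda>\<epsilon>. (norm (\<Sum>i<n. \<epsilon> i *\<^sub>R y i))\<^sup>2) \<le> c * (\<Sum>i<n. (norm (y i))\<^sup>2)"
  shows "finite B \<Longrightarrow> card B \<le> n ^ k \<Longrightarrow>
    sign_avg A (\<lambda>\<epsilon>. (norm (\<Sum>i\<in>B. \<epsilon> i *\<^sub>R x i))\<^sup>2) \<le> c ^ k * (\<Sum>i\<in>B. (norm (x i))\<^sup>2)"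
proof (induction k arbitrary: B)
  case 0
  hence "card B = 0 \<or> card B = 1" by (simp add: le_Suc_eq)
  hence "B = {} \<or> (\<exists>i. B = {i})" using \<open>finite B\<close> by (simp only: card_0_eq card_1_singleton_iff One_nat_def)
  then consider "B = {}" | i where "B = {i}" by blast
  thus ?case
  proof cases
    case 1 thus ?thesis using A by simp
  next
    case 2
    have "sign_avg A (\<lambda>\<epsilon>. (norm (\<Sum>i\<in>B. \<epsilon> i *\<^sub>R x i))\<^sup>2) \<le> sign_avg A (\<lambda>_. (norm (x i))\<^sup>2)"
      using norm_signed_sum_le[where B = B and x = x] 2 by (intro sign_avg_mono power_mono) auto
    thus ?thesis using A 2 by simp
  qed
next
  case (Suc k)
  obtain g where g: "g ` B \<subseteq> {..<n}" "\<And>b. card {i\<in>B. g i = b} \<le> n ^ k"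
    using obtain_partition_card_le[of B n "n ^ k"] Suc.prems by auto
  have "sign_avg A (\<lambda>\<epsilon>. (norm (\<Sum>i\<in>B. \<epsilon> i *\<^sub>R x i))\<^sup>2) \<le>
      c * (\<Sum>b<n. sign_avg A (\<lambda>\<epsilon>. (norm (\<Sum>i\<in>{i\<in>B. g i = b}. \<epsilon> i *\<^sub>R x i))\<^sup>2))"
    using A Suc.prems g avg by (intro sign_avg_blocks) auto
  also have "\<dots> \<le> c * (\<Sum>b<n. c ^ k * (\<Sum>i\<in>{i\<in>B. g i = b}. (norm (x i))\<^sup>2))"
    using Suc.prems g c by (intro mult_left_mono sum_mono Suc.IH) auto
  also have "\<dots> = c ^ Suc k * (\<Sum>b<n. \<Sum>i\<in>{i\<in>B. g i = b}. (norm (x i))\<^sup>2)"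
    by (simp add: sum_distrib_left mult.assoc)
  also have "(\<Sum>b<n. \<Sum>i\<in>{i\<in>B. g i = b}. (norm (x i))\<^sup>2) = (\<Sum>i\<in>B. (norm (x i))\<^sup>2)"
    using Suc.prems g by (intro sum.group) auto
  finally show ?case .
qed

section \<open>From second moments to a type exponent above 1\<close>

text \<open>Here \<open>r\<close> is the ratio of consecutive norm levels:
  \<open>n * r powr p = 1\<close> makes the number of vectors grow by a factor \<open>n\<close> per
  level. For \<open>p\<close> close to 1, \<open>n * r\<close> is so close to 1 that \<theta> wins,
  and \<open>v ^ 4\<close> bounds the decay of the second moments from level to level.\<close>

lemma exists_type_exponent:
  fixes \<theta> :: real and n :: nat
  assumes n: "n \<ge> 2" and \<theta>: "0 < \<theta>" "\<theta> < 1"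
  obtains p r v :: real where "1 < p" "p \<le> 2" "0 < r" "r < 1" "real n * r powr p = 1"
    "0 < v" "v < 1" "\<theta> * (real n)\<^sup>2 * r\<^sup>2 \<le> v ^ 4"
proof -
  \<comment> \<open>With this \<open>p\<close> the exponent \<open>2 - 2 / p\<close> equals
    \<open>s\<close>. The bound 1 on \<open>s\<close> keeps \<open>p \<le> 2\<close>; the other
    bound gives \<open>n powr s \<le> \<theta> powr (-1/2)\<close>, half of the available
    gain.\<close>
  define s where "s = min 1 (- ln \<theta> / (2 * ln n))"
  define p where "p = 2 / (2 - s)"
  define r where "r = real n powr (- 1 / p)"
  define v where "v = \<theta> powr (1 / 8)"
  have lnn: "ln (real n) > 0" using n by simp
  have s: "0 < s" "s \<le> 1" using lnn \<theta> by (auto simp: s_def divide_neg_pos)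
  have p: "1 < p" "p \<le> 2" using s by (auto simp: p_def field_simps)
  have r: "0 < r" "r < 1" using n p by (auto simp: r_def powr_less_one)
  have "r powr p = real n powr (-1)" using p by (simp add: r_def powr_powr)
  hence rp: "real n * r powr p = 1" using n by (simp add: powr_minus)
  have v: "0 < v" "v < 1" using \<theta> by (auto simp: v_def powr01_less_one)
  have v4: "v ^ 4 = \<theta> powr (1 / 2)" using \<theta> by (simp add: v_def powr_power)
  have "(real n)\<^sup>2 * r\<^sup>2 = real n powr 2 * real n powr (- 2 / p)"
    using n by (simp add: r_def powr_power)
  also have "\<dots> = real n powr (2 + - 2 / p)" by (rule powr_add[symmetric])
  also have "2 + - 2 / p = s" using s by (simp add: p_def field_simps)
  also have "real n powr s \<le> real n powr (- ln \<theta> / (2 * ln n))" using n by (intro powr_mono) (auto simp: s_def)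
  also have "\<dots> = \<theta> powr (- 1 / 2)" using n lnn \<theta> by (simp add: powr_def)
  finally have "\<theta> * ((real n)\<^sup>2 * r\<^sup>2) \<le> \<theta> * \<theta> powr (- 1 / 2)" using \<theta> by (intro mult_left_mono) auto
  also have "\<dots> = \<theta> powr 1 * \<theta> powr (- 1 / 2)" using \<theta> by simp
  also have "\<dots> = v ^ 4" unfolding v4 powr_add[symmetric] by simp
  finally show ?thesis using that[of p r v] p r rp v by (simp add: mult.assoc)
qed

lemma geometric_partial_sum_le:
  fixes q :: real
  assumes "0 \<le> q" "q < 1"
  shows "(\<Sum>j<J. q ^ j) \<le> 1 / (1 - q)"
  using assms by (simp add: sum_gp_strict divide_right_mono)

lemma power_level:
  fixes r t :: real
  assumes "0 < r" "r < 1" "0 < t" "t \<le> 1"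
  obtains j where "r ^ Suc j < t" "t \<le> r ^ j"
proof -
  define j where "j = (LEAST j. r ^ Suc j < t)"
  obtain k where "r ^ k < t" using real_arch_pow_inv[of t r] assms by auto
  moreover have "r ^ Suc k \<le> r ^ k" using assms by (intro power_decreasing) auto
  ultimately have ex: "r ^ Suc k < t" by linarith
  have "r ^ Suc j < t" unfolding j_def by (rule LeastI[of _ k]) (rule ex)
  moreover have "t \<le> r ^ j"
  proof (cases j)
    case 0 thus ?thesis using assms by simp
  next
    case (Suc i)
    hence "\<not> r ^ Suc i < t" using not_less_Least[of i "\<lambda>j. r ^ Suc j < t"] by (simp add: j_def)
    thus ?thesis using Suc by simp
  qed
  ultimately show ?thesis by (rule that)
qed

text \<open>Splitting the vectors according to the size of their norm into levels, the contributions
  decay geometrically since the number of vectors at level \<open>j\<close> is at most \<open>n ^ Suc j\<close>.\<close>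

lemma sign_avg_le_of_powr_sum_le_1:
  fixes x :: "'i \<Rightarrow> 'a::real_normed_vector"
  assumes A: "finite A" and \<theta>: "0 < \<theta>" and n: "n \<ge> 1"
  assumes avg: "\<And>y :: nat \<Rightarrow> 'a. sign_avg {..<n} (\<lambda>\<epsilon>. (norm (\<Sum>i<n. \<epsilon> i *\<^sub>R y i))\<^sup>2)
                  \<le> \<theta> * real n * (\<Sum>i<n. (norm (y i))\<^sup>2)"
  assumes p: "1 < p" and r: "0 < r" "r < 1" "real n * r powr p = 1"
    and v: "0 < v" "v < 1" "\<theta> * (real n)\<^sup>2 * r\<^sup>2 \<le> v ^ 4"
  assumes x: "(\<Sum>i\<in>A. norm (x i) powr p) \<le> 1"
  shows "sign_avg A (\<lambda>\<epsilon>. (norm (\<Sum>i\<in>A. \<epsilon> i *\<^sub>R x i))\<^sup>2) \<le> \<theta> * (real n)\<^sup>2 * (1 / (1 - v\<^sup>2))\<^sup>2"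
proof -
  \<comment> \<open>Zero vectors belong to no level.\<close>
  define A' where "A' = {i\<in>A. x i \<noteq> 0}"
  have A': "finite A'" "A' \<subseteq> A" using A by (auto simp: A'_def)
  have x1: "norm (x i) \<le> 1" if "i \<in> A" for i
  proof (rule ccontr)
    assume "\<not> norm (x i) \<le> 1"
    hence "1 < norm (x i) powr p" using p by (simp add: gr_one_powr)
    also have "norm (x i) powr p \<le> (\<Sum>i\<in>A. norm (x i) powr p)"
      using A that by (intro member_le_sum) auto
    finally show False using x by simp
  qed
  have "\<exists>j. r ^ Suc j < norm (x i) \<and> norm (x i) \<le> r ^ j" if "i \<in> A'" for i
    using power_level[of r "norm (x i)"] r that x1[of i] by (auto simp: A'_def)
  then obtain l where l: "\<And>i. i \<in> A' \<Longrightarrow> r ^ Suc (l i) < norm (x i) \<and> norm (x i) \<le> r ^ l i"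
    by metis
  define J where "J = Suc (Max (insert 0 (l ` A')))"
  have J: "l ` A' \<subseteq> {..<J}" using A' by (auto simp: J_def less_Suc_eq_le intro!: Max_ge)
  define B where "B j = {i\<in>A'. l i = j}" for j
  have B: "finite (B j)" "B j \<subseteq> A" for j using A' by (auto simp: B_def)
  define D where "D = \<theta> * (real n)\<^sup>2"
  have D: "D \<ge> 0" using \<theta> by (simp add: D_def)
  \<comment> \<open>Each vector of level \<open>j\<close> contributes at least
    \<open>(r ^ Suc j) powr p = 1 / n ^ Suc j\<close> to a sum that is at most 1.\<close>
  have cardB: "card (B j) \<le> n ^ Suc j" for j
  proof -
    have "real (card (B j)) * (r ^ Suc j) powr p = (\<Sum>i\<in>B j. (r ^ Suc j) powr p)" by simp
    also have "\<dots> \<le> (\<Sum>i\<in>B j. norm (x i) powr p)"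
      using l r p by (intro sum_mono powr_mono2) (auto simp: B_def less_imp_le)
    also have "\<dots> \<le> (\<Sum>i\<in>A. norm (x i) powr p)" using A B by (intro sum_mono2) auto
    also have "\<dots> \<le> 1" by (rule x)
    finally have "real (card (B j)) * (r ^ Suc j) powr p \<le> 1" .
    moreover have "(r ^ Suc j) powr p = (r powr p) ^ Suc j"
      using r by (simp add: powr_power powr_realpow[symmetric] powr_powr mult.commute del: power_Suc)
    moreover have "r powr p = 1 / real n" using r n by (simp add: field_simps)
    ultimately have "real (card (B j)) * (1 / real n) ^ Suc j \<le> 1" by (simp only:)
    hence "real (card (B j)) \<le> real n ^ Suc j"
      using n by (simp add: power_divide divide_le_eq del: power_Suc)
    thus ?thesis by (metis of_nat_le_iff of_nat_power)
  qed
  \<comment> \<open>Apply the power bound with exponent \<open>Suc j\<close>. The surplus factor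
    \<open>\<theta> * n^2\<close> is \<open>D\<close>; the rest is a \<open>j\<close>-th power with
    base at most \<open>v ^ 4\<close>.\<close>
  have level: "sign_avg A (\<lambda>\<epsilon>. (norm (\<Sum>i\<in>B j. \<epsilon> i *\<^sub>R x i))\<^sup>2) \<le> D * (v ^ 4) ^ j" for j
  proof -
    have "sign_avg A (\<lambda>\<epsilon>. (norm (\<Sum>i\<in>B j. \<epsilon> i *\<^sub>R x i))\<^sup>2)
        \<le> (\<theta> * n) ^ Suc j * (\<Sum>i\<in>B j. (norm (x i))\<^sup>2)"
      using A B \<theta> cardB avg by (intro sign_avg_power_bound) auto
    also have "\<dots> \<le> (\<theta> * n) ^ Suc j * (\<Sum>i\<in>B j. (r ^ j)\<^sup>2)"
      using \<theta> l by (intro mult_left_mono sum_mono power_mono) (auto simp: B_def)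
    also have "\<dots> = (\<theta> * n) ^ Suc j * (real (card (B j)) * (r ^ j)\<^sup>2)" by simp
    also have "\<dots> \<le> (\<theta> * n) ^ Suc j * (real (n ^ Suc j) * (r ^ j)\<^sup>2)"
      using \<theta> cardB[of j] by (intro mult_left_mono mult_right_mono) (auto simp del: power_Suc of_nat_power)
    also have "\<dots> = D * (\<theta> * (real n)\<^sup>2 * r\<^sup>2) ^ j"
      by (simp add: D_def power_mult_distrib power2_eq_square power_add algebra_simps)
    also have "\<dots> \<le> D * (v ^ 4) ^ j"
      using v \<theta> D by (intro mult_left_mono power_mono) auto
    finally show ?thesis .
  qed
  define G where "G = (\<Sum>j<J. (v\<^sup>2) ^ j)"
  have G: "0 \<le> G" "G \<le> 1 / (1 - v\<^sup>2)"
    using v geometric_partial_sum_le[of "v\<^sup>2" J]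
    by (auto simp: G_def intro!: sum_nonneg simp: power_less_one_iff abs_square_less_1)
  \<comment> \<open>Cauchy-Schwarz over the levels with weights \<open>v ^ j\<close>.\<close>
  have split: "(norm (\<Sum>i\<in>A. \<epsilon> i *\<^sub>R x i))\<^sup>2 \<le>
      G * (\<Sum>j<J. (1 / (v\<^sup>2) ^ j) * (norm (\<Sum>i\<in>B j. \<epsilon> i *\<^sub>R x i))\<^sup>2)" for \<epsilon> :: "'i \<Rightarrow> real"
  proof -
    have "(\<Sum>i\<in>A. \<epsilon> i *\<^sub>R x i) = (\<Sum>i\<in>A'. \<epsilon> i *\<^sub>R x i)"
      using A by (intro sum.mono_neutral_right) (auto simp: A'_def)
    also have "\<dots> = (\<Sum>j<J. \<Sum>i\<in>B j. \<epsilon> i *\<^sub>R x i)"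
      unfolding B_def using A' J by (intro sum.group[symmetric]) auto
    finally have "norm (\<Sum>i\<in>A. \<epsilon> i *\<^sub>R x i) \<le> (\<Sum>j<J. norm (\<Sum>i\<in>B j. \<epsilon> i *\<^sub>R x i))"
      by (simp add: norm_sum)
    also have "\<dots> = (\<Sum>j<J. v ^ j * (norm (\<Sum>i\<in>B j. \<epsilon> i *\<^sub>R x i) / v ^ j))"
      using v by simp
    finally have "(norm (\<Sum>i\<in>A. \<epsilon> i *\<^sub>R x i))\<^sup>2 \<le> (\<Sum>j<J. v ^ j * (norm (\<Sum>i\<in>B j. \<epsilon> i *\<^sub>R x i) / v ^ j))\<^sup>2"
      by (intro power_mono) auto
    also have "\<dots> \<le> (\<Sum>j<J. (v ^ j)\<^sup>2) * (\<Sum>j<J. (norm (\<Sum>i\<in>B j. \<epsilon> i *\<^sub>R x i) / v ^ j)\<^sup>2)"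
      by (rule Cauchy_Schwarz_ineq_sum)
    also have "\<dots> = G * (\<Sum>j<J. (1 / (v\<^sup>2) ^ j) * (norm (\<Sum>i\<in>B j. \<epsilon> i *\<^sub>R x i))\<^sup>2)"
      by (simp add: G_def power_divide power_mult[symmetric] mult.commute)
    finally show ?thesis .
  qed
  have "sign_avg A (\<lambda>\<epsilon>. (norm (\<Sum>i\<in>A. \<epsilon> i *\<^sub>R x i))\<^sup>2) \<le>
      sign_avg A (\<lambda>\<epsilon>. G * (\<Sum>j<J. (1 / (v\<^sup>2) ^ j) * (norm (\<Sum>i\<in>B j. \<epsilon> i *\<^sub>R x i))\<^sup>2))"
    by (intro sign_avg_mono split)
  also have "\<dots> = G * (\<Sum>j<J. (1 / (v\<^sup>2) ^ j) * sign_avg A (\<lambda>\<epsilon>. (norm (\<Sum>i\<in>B j. \<epsilon> i *\<^sub>R x i))\<^sup>2))"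
    by (simp only: sign_avg_cmult sign_avg_sum)
  also have "\<dots> \<le> G * (\<Sum>j<J. (1 / (v\<^sup>2) ^ j) * (D * (v ^ 4) ^ j))"
    using G v level by (intro mult_left_mono sum_mono) auto
  \<comment> \<open>Half of the decay \<open>(v ^ 4) ^ j\<close> pays for the weights; the other
    half sums to \<open>G\<close> again.\<close>
  also have "(\<Sum>j<J. (1 / (v\<^sup>2) ^ j) * (D * (v ^ 4) ^ j)) = (\<Sum>j<J. D * (v\<^sup>2) ^ j)"
  proof (intro sum.cong refl)
    fix j
    have "(v ^ 4) ^ j = (v\<^sup>2) ^ j * (v\<^sup>2) ^ j"
      by (simp add: power_mult[symmetric] power_add[symmetric])
    thus "(1 / (v\<^sup>2) ^ j) * (D * (v ^ 4) ^ j) = D * (v\<^sup>2) ^ j" using v by simp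
  qed
  also have "G * (\<Sum>j<J. D * (v\<^sup>2) ^ j) = D * G\<^sup>2"
    by (simp add: G_def sum_distrib_left[symmetric] power2_eq_square)
  also have "\<dots> \<le> D * (1 / (1 - v\<^sup>2))\<^sup>2" using D G by (intro mult_left_mono power_mono) auto
  finally show ?thesis by (simp add: D_def)
qed

text \<open>Homogeneity reduces the type inequality to vectors with \<open>p\<close>-th powers
  summing to 1, and \<open>a powr p \<le> 1 + a^2\<close> passes from second to \<open>p\<close>-th
  moments.\<close>

lemma has_rademacher_typeI:
  assumes p: "1 < p" "p \<le> 2" and K: "K \<ge> 0"
  assumes bound: "\<And>m (x :: nat \<Rightarrow> 'a::real_normed_vector). (\<Sum>i<m. norm (x i) powr p) \<le> 1 \<Longrightarrow>
    sign_avg {..<m} (\<lambda>\<epsilon>. (norm (\<Sum>i<m. \<epsilon> i *\<^sub>R x i))\<^sup>2) \<le> K"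
  shows "has_rademacher_type TYPE('a) p"
proof -
  have avg_le: "sign_avg {..<m} (\<lambda>\<epsilon>. norm (\<Sum>i<m. \<epsilon> i *\<^sub>R u i) powr p) \<le> (1 + K) * (\<Sum>i<m. norm (u i) powr p)"
    for m and u :: "nat \<Rightarrow> 'a"
  proof -
    define S where "S = (\<Sum>i<m. norm (u i) powr p)"
    show ?thesis
    proof (cases "S = 0")
      case True
      hence "u i = 0" if "i < m" for i
        using that sum_nonneg_eq_0_iff[of "{..<m}" "\<lambda>i. norm (u i) powr p"] by (auto simp: S_def)
      thus ?thesis by (simp add: sign_avg_def)
    next
      case False
      moreover have "S \<ge> 0" by (auto simp: S_def intro: sum_nonneg)
      ultimately have S: "S > 0" by simp
      define t where "t = S powr (1 / p)"
      have t: "t > 0" "t powr p = S" using S p by (auto simp: t_def powr_powr)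
      define x where "x i = u i /\<^sub>R t" for i
      have "(\<Sum>i<m. norm (x i) powr p) = (\<Sum>i<m. norm (u i) powr p / t powr p)"
        using t by (intro sum.cong refl) (simp add: x_def powr_mult powr_divide divide_inverse mult.commute inverse_powr)
      also have "\<dots> = 1" using t S by (simp add: sum_divide_distrib[symmetric] S_def)
      finally have avg_x: "sign_avg {..<m} (\<lambda>\<epsilon>. (norm (\<Sum>i<m. \<epsilon> i *\<^sub>R x i))\<^sup>2) \<le> K" using bound[of x m] by simp
      have u_eq: "norm (\<Sum>i<m. \<epsilon> i *\<^sub>R u i) powr p = S * norm (\<Sum>i<m. \<epsilon> i *\<^sub>R x i) powr p" for \<epsilon>
      proof -
        have "(\<Sum>i<m. \<epsilon> i *\<^sub>R u i) = t *\<^sub>R (\<Sum>i<m. \<epsilon> i *\<^sub>R x i)"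
          unfolding scaleR_sum_right using t by (intro sum.cong refl) (simp add: x_def)
        thus ?thesis using t by (simp add: powr_mult)
      qed
      have powr_le: "a powr p \<le> 1 + a\<^sup>2" if "a \<ge> 0" for a :: real
      proof (cases "a \<le> 1")
        case True
        hence "a powr p \<le> 1" using that p powr_mono2[of p a 1] by simp
        thus ?thesis using zero_le_power2[of a] by linarith
      next
        case False
        hence "a powr p \<le> a powr 2" using p by (intro powr_mono) auto
        thus ?thesis using False by simp
      qed
      have "sign_avg {..<m} (\<lambda>\<epsilon>. norm (\<Sum>i<m. \<epsilon> i *\<^sub>R u i) powr p)
          \<le> sign_avg {..<m} (\<lambda>\<epsilon>. S * (1 + (norm (\<Sum>i<m. \<epsilon> i *\<^sub>R x i))\<^sup>2))"
        unfolding u_eq using S by (intro sign_avg_mono mult_left_mono powr_le) auto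
      also have "\<dots> = S * (1 + sign_avg {..<m} (\<lambda>\<epsilon>. (norm (\<Sum>i<m. \<epsilon> i *\<^sub>R x i))\<^sup>2))"
        by (simp add: sign_avg_cmult sign_avg_add)
      also have "\<dots> \<le> S * (1 + K)" using S avg_x by (intro mult_left_mono) auto
      finally show ?thesis by (simp add: S_def mult.commute)
    qed
  qed
  show ?thesis
    unfolding has_rademacher_type_def
  proof (intro exI[of _ "(1 + K) powr (1 / p)"] allI)
    fix m and u :: "nat \<Rightarrow> 'a"
    have "(sign_avg {..<m} (\<lambda>\<epsilon>. norm (\<Sum>i<m. \<epsilon> i *\<^sub>R u i) powr p)) powr (1 / p)
        \<le> ((1 + K) * (\<Sum>i<m. norm (u i) powr p)) powr (1 / p)"
      using p by (intro powr_mono2 avg_le) (auto simp: sign_avg_def sum_nonneg)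
    also have "\<dots> = (1 + K) powr (1 / p) * (\<Sum>i<m. norm (u i) powr p) powr (1 / p)"
      by (rule powr_mult)
    finally show "(measure_pmf.expectation (Pi_pmf {..<m} 0 (\<lambda>_. pmf_of_set {-1, 1::real}))
           (\<lambda>\<epsilon>. norm (\<Sum>i<m. \<epsilon> i *\<^sub>R u i) powr p)) powr (1 / p)
        \<le> (1 + K) powr (1 / p) * (\<Sum>i<m. norm (u i) powr p) powr (1 / p)"
      by (simp add: rademacher_expectation_eq_sign_avg)
  qed
qed

text \<open>The part of Pisier's theorem used here: if such vectors did not exist, the preceding
  estimates would yield a type exponent \<open>p > 1\<close> and push the supremum above 1.\<close>

lemma trivial_type_imp_not_b_convex:
  assumes triv: "trivial_type TYPE('a::real_normed_vector)" and n: "n \<ge> 2" and \<delta>: "\<delta> > 0"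
  obtains u :: "nat \<Rightarrow> 'a::real_normed_vector" where "\<And>i. norm (u i) \<le> 1"
    "\<And>\<epsilon>. \<epsilon> \<in> signs {..<n} \<Longrightarrow> norm (\<Sum>i<n. \<epsilon> i *\<^sub>R u i) > (1 - \<delta>) * real n"
proof (rule ccontr)
  assume "\<not> thesis"
  with that have bconv: "\<exists>\<epsilon>\<in>signs {..<n}. norm (\<Sum>i<n. \<epsilon> i *\<^sub>R u i) \<le> (1 - \<delta>) * real n"
    if "\<And>i. norm (u i) \<le> 1" for u :: "nat \<Rightarrow> 'a"
    using \<open>\<And>i. norm (u i) \<le> 1\<close> by (meson not_le)
  obtain \<theta> where \<theta>: "0 < \<theta>" "\<theta> < 1" and avg: "\<And>y :: nat \<Rightarrow> 'a.
     sign_avg {..<n} (\<lambda>\<epsilon>. (norm (\<Sum>i<n. \<epsilon> i *\<^sub>R y i))\<^sup>2) \<le> \<theta> * real n * (\<Sum>i<n. (norm (y i))\<^sup>2)"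
    using b_convex_imp_average_bound[of n \<delta>] bconv n \<delta> by auto
  obtain p r v :: real where p: "1 < p" "p \<le> 2" and r: "0 < r" "r < 1" "real n * r powr p = 1"
    and v: "0 < v" "v < 1" "\<theta> * (real n)\<^sup>2 * r\<^sup>2 \<le> v ^ 4"
    using exists_type_exponent[OF n \<theta>] by blast
  have "has_rademacher_type TYPE('a) p"
  proof (rule has_rademacher_typeI[OF p])
    show "0 \<le> \<theta> * (real n)\<^sup>2 * (1 / (1 - v\<^sup>2))\<^sup>2" using \<theta> by simp
    show "sign_avg {..<m} (\<lambda>\<epsilon>. (norm (\<Sum>i<m. \<epsilon> i *\<^sub>R x i))\<^sup>2) \<le> \<theta> * (real n)\<^sup>2 * (1 / (1 - v\<^sup>2))\<^sup>2"
      if "(\<Sum>i<m. norm (x i) powr p) \<le> 1" for m and x :: "nat \<Rightarrow> 'a"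
      using n by (intro sign_avg_le_of_powr_sum_le_1[OF _ \<theta>(1) _ avg p(1) r v that]) auto
  qed
  hence "p \<le> Sup {p \<in> {1..2}. has_rademacher_type TYPE('a) p}"
    using p by (intro cSup_upper) (auto intro!: bdd_aboveI[of _ 2])
  thus False using triv p by (simp add: trivial_type_def)
qed

section \<open>Almost isometric copies of l1 from the dual\<close>

lemma blinfun_norm_attained_approx:
  fixes g :: "'a::real_normed_vector \<Rightarrow>\<^sub>L real"
  assumes "0 \<le> c" "c < norm g"
  obtains x where "norm x \<le> 1" "c < blinfun_apply g x"
proof -
  have "\<not> (\<forall>x. norm (blinfun_apply g x) \<le> c * norm x)"
    using assms norm_blinfun_bound[of c g] by auto
  then obtain x where x: "c * norm x < \<bar>blinfun_apply g x\<bar>" by (auto simp: not_le)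
  hence "x \<noteq> 0" by auto
  define z where "z = (sgn (blinfun_apply g x) / norm x) *\<^sub>R x"
  show ?thesis
  proof
    show "norm z \<le> 1" using \<open>x \<noteq> 0\<close> by (simp add: z_def abs_sgn_eq)
    have "blinfun_apply g z = \<bar>blinfun_apply g x\<bar> / norm x"
      by (simp add: z_def blinfun.bilinear_simps abs_sgn mult.commute)
    thus "c < blinfun_apply g z" using x \<open>x \<noteq> 0\<close> by (simp add: pos_less_divide_eq)
  qed
qed

text \<open>The functionals \<open>f i\<close> are indexed by the sign patterns on \<open>J\<close>, and \<open>y j\<close> almost norms the sum
  of the \<open>f i\<close> weighted with the \<open>j\<close>-th sign of each pattern. Then every \<open>f i\<close> almost attains its
  prescribed sign at \<open>y j\<close>.\<close>

lemma trivial_type_dual_imp_almost_l1: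
  assumes triv: "trivial_type TYPE('a::real_normed_vector \<Rightarrow>\<^sub>L real)"
    and J: "finite J" "J \<noteq> {}" and \<eta>: "0 < \<eta>" "\<eta> \<le> 1"
  obtains y :: "'j \<Rightarrow> 'a::real_normed_vector" where "\<And>j. j \<in> J \<Longrightarrow> norm (y j) \<le> 1"
    "\<And>a. (1 - \<eta>) * (\<Sum>j\<in>J. \<bar>a j\<bar>) \<le> norm (\<Sum>j\<in>J. a j *\<^sub>R y j)"
proof -
  define n where "n = card (signs J)"
  have "2 ^ 1 \<le> (2::nat) ^ card J" using J by (intro power_increasing) (auto simp: Suc_le_eq card_gt_0_iff)
  hence n: "n \<ge> 2" using J by (simp add: n_def card_signs)
  obtain e where e: "bij_betw e {0..<n} (signs J)"
    using ex_bij_betw_nat_finite[of "signs J"] J by (auto simp: n_def)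
  \<comment> \<open>With defect \<open>\<eta> / n\<close> the signed sums have norm above
    \<open>n - \<eta>\<close>. At an almost norming vector all \<open>n\<close> terms are at most 1,
    so no single term can fall below \<open>1 - \<eta>\<close>.\<close>
  obtain f :: "nat \<Rightarrow> 'a \<Rightarrow>\<^sub>L real" where f: "\<And>i. norm (f i) \<le> 1"
    and f_sum: "\<And>\<epsilon>. \<epsilon> \<in> signs {..<n} \<Longrightarrow> norm (\<Sum>i<n. \<epsilon> i *\<^sub>R f i) > (1 - \<eta> / n) * real n"
    using trivial_type_imp_not_b_convex[OF triv n, of "\<eta> / n"] n \<eta> by auto
  have e_signs: "e i \<in> signs J" if "i < n" for i using bij_betwE[OF e] that by auto
  have f_le: "\<bar>blinfun_apply (f i) x\<bar> \<le> norm x" for i x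
    using norm_blinfun[of "f i" x] mult_right_mono[OF f[of i] norm_ge_zero[of x]] by simp
  have "\<exists>y. norm y \<le> 1 \<and> (\<forall>i<n. 1 - \<eta> \<le> e i j * blinfun_apply (f i) y)" if j: "j \<in> J" for j
  proof -
    define \<epsilon> where "\<epsilon> i = (if i < n then e i j else 0)" for i
    have "\<epsilon> \<in> signs {..<n}"
      using signs_cases[OF e_signs j] by (auto simp: \<epsilon>_def signs_def PiE_dflt_def)
    hence "norm (\<Sum>i<n. \<epsilon> i *\<^sub>R f i) > (1 - \<eta> / n) * real n" by (rule f_sum)
    moreover have eq: "(1 - \<eta> / n) * real n = n - \<eta>" using n by (simp add: field_simps)
    ultimately obtain y where y: "norm y \<le> 1" "n - \<eta> < blinfun_apply (\<Sum>i<n. \<epsilon> i *\<^sub>R f i) y"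
      using blinfun_norm_attained_approx[of "n - \<eta>" "\<Sum>i<n. \<epsilon> i *\<^sub>R f i"] n \<eta> by auto
    have "1 - \<eta> \<le> e i j * blinfun_apply (f i) y" if i: "i < n" for i
    proof -
      have le1: "e i j * blinfun_apply (f i) y \<le> 1" if "i < n" for i
      proof -
        have "e i j * blinfun_apply (f i) y \<le> \<bar>e i j\<bar> * \<bar>blinfun_apply (f i) y\<bar>"
          by (simp add: abs_mult[symmetric])
        also have "\<dots> \<le> 1 * 1"
          using signs_abs_le[OF e_signs[OF that]] f_le[of i y] y by (intro mult_mono) auto
        finally show ?thesis by simp
      qed
      have "n - \<eta> < (\<Sum>i<n. e i j * blinfun_apply (f i) y)"
        using y by (simp add: blinfun.bilinear_simps blinfun.sum_left \<epsilon>_def)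
      also have "\<dots> = e i j * blinfun_apply (f i) y + (\<Sum>i\<in>{..<n} - {i}. e i j * blinfun_apply (f i) y)"
        using i by (intro sum.remove) auto
      also have "(\<Sum>i\<in>{..<n} - {i}. e i j * blinfun_apply (f i) y) \<le> (\<Sum>i\<in>{..<n} - {i}. 1)"
        by (intro sum_mono le1) auto
      also have "\<dots> = real n - 1" using i by (simp add: of_nat_diff)
      finally show ?thesis by simp
    qed
    thus ?thesis using y by blast
  qed
  then obtain y where y: "\<And>j. j \<in> J \<Longrightarrow> norm (y j) \<le> 1"
    "\<And>j i. j \<in> J \<Longrightarrow> i < n \<Longrightarrow> 1 - \<eta> \<le> e i j * blinfun_apply (f i) (y j)"
    by metis
  show ?thesis
  proof
    show "norm (y j) \<le> 1" if "j \<in> J" for j using y that by blast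
    fix a :: "'j \<Rightarrow> real"
    \<comment> \<open>The sign pattern of the coefficients: the functional indexed by it makes every
      term of the combination almost \<open>\<bar>a j\<bar>\<close>.\<close>
    define \<phi> where "\<phi> j = (if j \<in> J then if a j < 0 then -1 else 1 else (0::real))" for j
    have "\<phi> \<in> signs J" by (auto simp: \<phi>_def signs_def PiE_dflt_def)
    then obtain i where i: "i < n" "e i = \<phi>" using bij_betw_imp_surj_on[OF e] by (metis atLeastLessThan_iff imageE)
    have "(1 - \<eta>) * (\<Sum>j\<in>J. \<bar>a j\<bar>) = (\<Sum>j\<in>J. \<bar>a j\<bar> * (1 - \<eta>))"
      by (simp add: sum_distrib_left mult.commute)
    also have "\<dots> \<le> (\<Sum>j\<in>J. \<bar>a j\<bar> * (e i j * blinfun_apply (f i) (y j)))"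
      using y i by (intro sum_mono mult_left_mono) auto
    also have "\<dots> = (\<Sum>j\<in>J. a j * blinfun_apply (f i) (y j))"
      unfolding i by (intro sum.cong refl) (auto simp: \<phi>_def)
    also have "\<dots> = blinfun_apply (f i) (\<Sum>j\<in>J. a j *\<^sub>R y j)"
      by (simp add: blinfun.sum_right blinfun.scaleR_right)
    also have "\<dots> \<le> norm (\<Sum>j\<in>J. a j *\<^sub>R y j)" using f_le[of i "\<Sum>j\<in>J. a j *\<^sub>R y j"] by linarith
    finally show "(1 - \<eta>) * (\<Sum>j\<in>J. \<bar>a j\<bar>) \<le> norm (\<Sum>j\<in>J. a j *\<^sub>R y j)" .
  qed
qed

section \<open>The family indexed by half-size subsets\<close>

definition half_subsets :: "nat \<Rightarrow> nat set set" where
  "half_subsets k = {S. S \<subseteq> {..<2 * k} \<and> card S = k}"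

text \<open>Coefficients of convex combinations supported on the sets through \<open>i\<close>.
  Working with coefficients instead of points of the space makes the separation estimate purely
  combinatorial.\<close>

definition weights_through :: "nat \<Rightarrow> nat \<Rightarrow> (nat set \<Rightarrow> real) set" where
  "weights_through k i = {w. (\<forall>S\<in>half_subsets k. 0 \<le> w S \<and> (i \<notin> S \<longrightarrow> w S = 0)) \<and> (\<Sum>S\<in>half_subsets k. w S) = 1}"

lemma finite_half_subsets [simp]: "finite (half_subsets k)"
  unfolding half_subsets_def by (rule finite_subset[of _ "Pow {..<2 * k}"]) auto

text \<open>For \<open>j \<noteq> 0\<close>, the mass that \<open>w 0\<close> gives to the sets containing \<open>j\<close> is \<open>(k - 1) / (2 k - 1)\<close> on
  average, and only this mass can be shared with \<open>w j\<close>.\<close>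

lemma weights_through_far_apart:
  assumes k: "k \<ge> 1" and w: "\<And>i. i < 2 * k \<Longrightarrow> w i \<in> weights_through k i"
  shows "\<exists>j<2 * k. 2 * (real k / (2 * real k - 1)) \<le> (\<Sum>S\<in>half_subsets k. \<bar>w 0 S - w j S\<bar>)"
proof -
  let ?H = "half_subsets k"
  define t where "t j = (\<Sum>S\<in>?H. if j \<in> S then w 0 S else 0)" for j
  have w0: "w 0 \<in> weights_through k 0" using w k by simp
  \<comment> \<open>Double counting: each \<open>S\<close> has \<open>k\<close> elements, so its
    weight is counted \<open>k\<close> times.\<close>
  have "(\<Sum>j<2 * k. t j) = (\<Sum>S\<in>?H. \<Sum>j<2 * k. if j \<in> S then w 0 S else 0)"
    unfolding t_def by (rule sum.swap)
  also have "\<dots> = (\<Sum>S\<in>?H. real k * w 0 S)"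
  proof (intro sum.cong refl)
    fix S assume "S \<in> ?H"
    hence "{..<2 * k} \<inter> S = S" "card S = k" by (auto simp: half_subsets_def)
    thus "(\<Sum>j<2 * k. if j \<in> S then w 0 S else 0) = real k * w 0 S"
      by (simp add: sum.inter_restrict[symmetric])
  qed
  also have "\<dots> = k" using w0 by (simp add: sum_distrib_left[symmetric] weights_through_def)
  finally have t_sum: "(\<Sum>j<2 * k. t j) = k" .
  have "t 0 = (\<Sum>S\<in>?H. w 0 S)"
    unfolding t_def using w0 by (intro sum.cong refl) (auto simp: weights_through_def)
  hence t0: "t 0 = 1" using w0 by (simp add: weights_through_def)
  \<comment> \<open>Index 0 takes mass 1, leaving \<open>k - 1\<close> for the other
    \<open>2 * k - 1\<close> indices.\<close>
  have "(\<Sum>j<2 * k. t j) = t 0 + (\<Sum>j\<in>{..<2 * k} - {0}. t j)" using k by (intro sum.remove) auto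
  hence t_rest: "(\<Sum>j\<in>{..<2 * k} - {0}. t j) = real k - 1" using t_sum t0 by simp
  have "\<exists>j\<in>{..<2 * k} - {0}. t j \<le> (real k - 1) / (2 * real k - 1)"
  proof (rule ccontr)
    assume neg: "\<not> ?thesis"
    have "1 \<in> {..<2 * k} - {0::nat}" using k by simp
    hence "(\<Sum>j\<in>{..<2 * k} - {0::nat}. (real k - 1) / (2 * real k - 1)) < (\<Sum>j\<in>{..<2 * k} - {0}. t j)"
      using neg by (intro sum_strict_mono) (auto simp: not_le)
    thus False using k unfolding t_rest by (simp add: of_nat_diff)
  qed
  then obtain j where j: "j < 2 * k" "t j \<le> (real k - 1) / (2 * real k - 1)" by auto
  have wj: "w j \<in> weights_through k j" using w j by simp
  have "2 * (real k / (2 * real k - 1)) = 2 - 2 * ((real k - 1) / (2 * real k - 1))"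
    using k by (simp add: field_simps)
  also have "\<dots> \<le> 2 - 2 * t j" using j by linarith
  \<comment> \<open>Compare termwise: if \<open>j\<close> is not in \<open>S\<close>, then
    \<open>w j S = 0\<close> and the term is \<open>w 0 S\<close>; otherwise it is
    \<open>w j S - w 0 S\<close>.\<close>
  also have "\<dots> = (\<Sum>S\<in>?H. w 0 S + w j S - 2 * (if j \<in> S then w 0 S else 0))"
    using w0 wj by (simp add: sum.distrib sum_subtractf sum_distrib_left[symmetric] t_def weights_through_def)
  also have "\<dots> \<le> (\<Sum>S\<in>?H. \<bar>w 0 S - w j S\<bar>)"
    using wj by (intro sum_mono) (auto simp: weights_through_def)
  finally show ?thesis using j by blast
qed

text \<open>Here \<eta> serves twice: as the defect of the l1 copy, and as slack in choosing
  approximants, since the distance to a set \<open>C i\<close> need not be attained.\<close>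

lemma helly_bound_lower_estimate:
  assumes triv: "trivial_type TYPE('a::real_normed_vector \<Rightarrow>\<^sub>L real)"
    and k: "k \<ge> 1" and \<eta>: "0 < \<eta>" "\<eta> \<le> 1" and \<alpha>: "helly_bound TYPE('a) k \<alpha>"
  shows "(1 - \<eta>) * (real k / (2 * real k - 1)) \<le> \<alpha> + \<eta>"
proof -
  let ?H = "half_subsets k"
  have "{..<k} \<in> ?H" by (auto simp: half_subsets_def)
  then obtain y :: "nat set \<Rightarrow> 'a" where y: "\<And>S. S \<in> ?H \<Longrightarrow> norm (y S) \<le> 1"
    and l1: "\<And>a. (1 - \<eta>) * (\<Sum>S\<in>?H. \<bar>a S\<bar>) \<le> norm (\<Sum>S\<in>?H. a S *\<^sub>R y S)"
    using trivial_type_dual_imp_almost_l1[OF triv, of ?H \<eta>] \<eta> by auto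
  define z where "z w = (\<Sum>S\<in>?H. w S *\<^sub>R y S)" for w
  define C where "C i = z ` weights_through k i" for i
  have C_convex: "convex (C i)" for i
    unfolding convex_def C_def
  proof (intro ballI allI impI, elim imageE, hypsubst)
    fix u v :: real and w w' :: "nat set \<Rightarrow> real"
    assume uv: "0 \<le> u" "0 \<le> v" "u + v = 1" and w: "w \<in> weights_through k i" "w' \<in> weights_through k i"
    have "u *\<^sub>R z w + v *\<^sub>R z w' = z (\<lambda>S. u * w S + v * w' S)"
      by (simp add: z_def scaleR_sum_right sum.distrib algebra_simps)
    moreover have "(\<lambda>S. u * w S + v * w' S) \<in> weights_through k i"
      using uv w by (auto simp: weights_through_def sum.distrib sum_distrib_left[symmetric])
    ultimately show "u *\<^sub>R z w + v *\<^sub>R z w' \<in> z ` weights_through k i" by simp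
  qed
  have C_ball: "C i \<subseteq> cball 0 1" for i
  proof
    fix x assume "x \<in> C i"
    then obtain w where w: "w \<in> weights_through k i" "x = z w" by (auto simp: C_def)
    have "norm x \<le> (\<Sum>S\<in>?H. w S)" unfolding w(2) z_def
    proof (rule sum_norm_le)
      fix S assume "S \<in> ?H"
      thus "norm (w S *\<^sub>R y S) \<le> w S"
        using w y[of S] mult_left_le[of "norm (y S)" "w S"] by (simp add: weights_through_def)
    qed
    thus "x \<in> cball 0 1" using w by (simp add: weights_through_def)
  qed
  have y_in_C: "y S \<in> C i" if "S \<in> ?H" "i \<in> S" for S i
  proof -
    define w where "w T = (if T = S then 1 else (0::real))" for T
    have "w \<in> weights_through k i" using that by (auto simp: w_def weights_through_def)
    moreover have "z w = (\<Sum>T\<in>?H. if T = S then y T else 0)"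
      unfolding z_def w_def by (intro sum.cong refl) auto
    hence "z w = y S" using that by simp
    ultimately show ?thesis unfolding C_def by (metis image_eqI)
  qed
  have inter: "\<Inter>\<G> \<noteq> {}" if \<G>: "\<G> \<subseteq> C ` {..<2 * k}" "card \<G> \<le> k" for \<G>
  proof -
    \<comment> \<open>Indices are chosen so that \<open>C\<close> is injective on \<open>I\<close>;
      hence \<open>card I \<le> k\<close> even if some of the sets coincide, and \<open>I\<close>
      extends to a \<open>k\<close>-subset.\<close>
    obtain I where I: "I \<subseteq> {..<2 * k}" "inj_on C I" "\<G> = C ` I"
      using \<G>(1) by (auto simp: subset_image_inj)
    have "card I \<le> k" using \<G>(2) I by (simp add: card_image)
    then obtain S where S: "I \<subseteq> S" "S \<subseteq> {..<2 * k}" "card S = k"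
      using exists_subset_between[of I k "{..<2 * k}"] I by auto
    have "y S \<in> \<Inter>\<G>" using S I y_in_C[of S] by (auto simp: half_subsets_def)
    thus ?thesis by blast
  qed
  have "finite (C ` {..<2 * k}) \<and> (\<forall>D\<in>C ` {..<2 * k}. convex D \<and> D \<subseteq> cball 0 1) \<and>
      (\<forall>\<G>. \<G> \<subseteq> C ` {..<2 * k} \<and> card \<G> \<le> k \<longrightarrow> \<Inter>\<G> \<noteq> {})"
    using C_convex C_ball inter by (intro conjI allI impI ballI) auto
  then obtain x where "\<forall>D\<in>C ` {..<2 * k}. infdist x D \<le> \<alpha>"
    using \<alpha> unfolding helly_bound_def by meson
  hence x: "infdist x (C i) \<le> \<alpha>" if "i < 2 * k" for i using that by simp
  have "\<exists>w. w \<in> weights_through k i \<and> dist x (z w) < \<alpha> + \<eta>" if i: "i < 2 * k" for i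
  proof -
    have "C i \<noteq> {}" using inter[of "{C i}"] i k by auto
    moreover have "infdist x (C i) < \<alpha> + \<eta>" using x[OF i] \<eta> by simp
    ultimately obtain c where "c \<in> C i" "dist x c < \<alpha> + \<eta>"
      by (auto simp: infdist_notempty cINF_less_iff)
    thus ?thesis by (auto simp: C_def)
  qed
  then obtain w where w: "\<And>i. i < 2 * k \<Longrightarrow> w i \<in> weights_through k i"
    "\<And>i. i < 2 * k \<Longrightarrow> dist x (z (w i)) < \<alpha> + \<eta>"
    by metis
  obtain j where j: "j < 2 * k" "2 * (real k / (2 * real k - 1)) \<le> (\<Sum>S\<in>?H. \<bar>w 0 S - w j S\<bar>)"
    using weights_through_far_apart[OF k w(1)] by blast
  have "(1 - \<eta>) * (2 * (real k / (2 * real k - 1))) \<le> (1 - \<eta>) * (\<Sum>S\<in>?H. \<bar>w 0 S - w j S\<bar>)"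
    using j \<eta> by (intro mult_left_mono) auto
  also have "\<dots> \<le> norm (\<Sum>S\<in>?H. (w 0 S - w j S) *\<^sub>R y S)" by (rule l1)
  also have "\<dots> = dist (z (w 0)) (z (w j))"
    by (simp add: dist_norm z_def scaleR_diff_left sum_subtractf)
  also have "\<dots> \<le> dist x (z (w 0)) + dist x (z (w j))" by (rule dist_triangle3)
  also have "\<dots> \<le> 2 * (\<alpha> + \<eta>)" using w(2)[of 0] w(2)[of j] j k by simp
  finally show ?thesis unfolding mult.left_commute[of _ 2] by (rule mult_left_le_imp_le) simp
qed

lemma Helly_lower_bound:
  assumes triv: "trivial_type TYPE('a::real_normed_vector \<Rightarrow>\<^sub>L real)" and k: "k \<ge> 1"
  shows "real k / (2 * real k - 1) \<le> Helly TYPE('a) k"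
  unfolding Helly_def
proof (rule cInf_greatest)
  show "{\<alpha>. 0 < \<alpha> \<and> helly_bound TYPE('a) k \<alpha>} \<noteq> {}"
    using helly_bound_1[OF k, where X = "TYPE('a)"] by (auto intro: exI[of _ 1])
  fix \<alpha> assume "\<alpha> \<in> {\<alpha>. 0 < \<alpha> \<and> helly_bound TYPE('a) k \<alpha>}"
  hence \<alpha>: "helly_bound TYPE('a) k \<alpha>" by simp
  let ?R = "real k / (2 * real k - 1)"
  have R: "?R \<le> 1" using k by (simp add: field_simps)
  show "?R \<le> \<alpha>"
  proof (rule field_le_epsilon)
    fix e :: real assume "0 < e"
    \<comment> \<open>As the target ratio is at most 1, the estimate loses at most
      \<open>2 * \<eta>\<close>.\<close>
    define \<eta> where "\<eta> = min 1 (e / 2)"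
    have \<eta>: "0 < \<eta>" "\<eta> \<le> 1" "2 * \<eta> \<le> e" using \<open>0 < e\<close> by (auto simp: \<eta>_def)
    have "?R - \<eta> * ?R \<le> \<alpha> + \<eta>"
      using helly_bound_lower_estimate[OF triv k \<eta>(1,2) \<alpha>] by (simp only: left_diff_distrib mult_1)
    moreover have "\<eta> * ?R \<le> \<eta>" using mult_left_le[OF R, of \<eta>] \<eta> by simp
    ultimately show "?R \<le> \<alpha> + e" using \<eta> by linarith
  qed
qed

theorem corollary8p1:
  assumes "trivial_type TYPE('a::banach \<Rightarrow>\<^sub>L real)"
  shows "(\<forall>k::nat. k \<ge> 1 \<longrightarrow>
            Helly TYPE('a) k \<ge> real k / (2 * real k - 1) \<and>
            real k / (2 * real k - 1) \<ge> 1 / 2) \<and>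
         \<not> helly_approximation_property TYPE('a)"
proof -
  have bounds: "real k / (2 * real k - 1) \<le> Helly TYPE('a) k" "1 / 2 \<le> real k / (2 * real k - 1)"
    if "k \<ge> 1" for k
    using Helly_lower_bound[OF assms that] that by (auto simp: field_simps)
  moreover have "\<not> Helly TYPE('a) \<longlonglongrightarrow> 0"
  proof
    assume "Helly TYPE('a) \<longlonglongrightarrow> 0"
    moreover have "\<forall>\<^sub>F k in sequentially. 1 / 2 \<le> Helly TYPE('a) k"
      using eventually_ge_at_top[of 1] by eventually_elim (use bounds in \<open>meson order_trans\<close>)
    ultimately have "1 / 2 \<le> (0::real)" by (intro tendsto_lowerbound) auto
    thus False by simp
  qed
  ultimately show ?thesis by (simp add: helly_approximation_property_def)
qed

end
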